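(* Let $T$ be a tournament and let $H$ be a digraph with $\Delta(G(H))\le 2$. Then the number of copies of $H$ in $T$ equals the number of copies of $H$ in the complement $\overline{T}$ of $T$.
   Context: Digraphs are finite. A tournament is an orientation of a finite complete graph. $\overline{T}$, the complement of $T$, is the tournament obtained from $T$ by reversing all arcs. $G(H)$ is the underlying undirected graph of $H$ and $\Delta$ denotes maximum degree. A copy of $H$ in a tournament is a (not necessarily induced, not necessarily spanning) subdigraph isomorphic to $H$; copies are counted as subdigraphs. *)

theory Defs
  imports "Graph_Theory.Graph_Theory"
begin

locale tournament = digraph +
  assumes exactly_one_arc:
    "\<lbrakk>u \<in> verts G; v \<in> verts G; u \<noteq> v\<rbrakk> \<Longrightarrow> u \<rightarrow>\<^bsub>G\<^esub> v \<longleftrightarrow> \<not> v \<rightarrow>\<^bsub>G\<^esub> u"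

text \<open>The complement is taken in the sense of tournaments: every arc is reversed.\<close>

definition complement :: "('a,'b) pre_digraph \<Rightarrow> ('a,'b) pre_digraph" where
  "complement G = \<lparr>verts = verts G, arcs = arcs G, tail = head G, head = tail G\<rparr>"

text \<open>
  Undirected graphs are represented as symmetric digraphs without parallel arcs, so the
  undirected degree of a vertex is its out-degree. The value for the null graph is \<open>0\<close>.
\<close>

definition max_degree :: "('a,'b) pre_digraph \<Rightarrow> nat" where
  "max_degree G = Max (insert 0 (out_degree G ` verts G))"

text \<open>
  Since \<^const>\<open>subgraph\<close> forces the tail and head functions to agree with those of \<open>G\<close>,
  a copy is determined by its vertex set and its arc set.
\<close>

definition copies :: "('c,'d) pre_digraph \<Rightarrow> ('a,'b) pre_digraph \<Rightarrow> ('a,'b) pre_digraph set" where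
  "copies H G = {S. subgraph S G \<and> digraph_iso H S}"

lemma arcs_ends_complement: "arcs_ends (complement G) = (arcs_ends G)\<inverse>"
  by (auto simp: complement_def arcs_ends_conv)

lemma (in tournament) tournament_complement: "tournament (complement G)"
proof (unfold_locales, goal_cases)
  case (6 e1 e2)
  then show ?case
    using no_multi_arcs[of e1 e2] by (simp add: complement_def arc_to_ends_def)
next
  case (7 u v)
  then show ?case
    using exactly_one_arc[of u v] by (auto simp: arcs_ends_complement, simp_all add: complement_def)
qed (auto simp: complement_def dest: no_loops)

lemma (in tournament) complete_mk_symmetric: "K\<^bsub>card (verts G)\<^esub> (with_proj (mk_symmetric G))"
proof -
  interpret S: pair_digraph "mk_symmetric G" ..
  have "parcs (mk_symmetric G) = arcs_ends G \<union> (arcs_ends G)\<inverse>"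
    by (auto simp: mk_symmetric_def arcs_ends_conv)
  also have "\<dots> = {(u, v). (u, v) \<in> verts G \<times> verts G \<and> u \<noteq> v}"
    using exactly_one_arc by (auto dest: adj_in_verts adj_not_same)
  finally show ?thesis
    using S.pair_fin_digraph by (auto simp: complete_digraph_pair_def mk_symmetric_def)
qed

lemma (in fin_digraph) finite_copies: "finite (copies H G)"
proof -
  let ?f = "\<lambda>(V, A). \<lparr>verts = V, arcs = A, tail = tail G, head = head G\<rparr>"
  have "S \<in> ?f ` (Pow (verts G) \<times> Pow (arcs G))" if "subgraph S G" for S
    using that by (intro image_eqI[where x = "(verts S, arcs S)"])
      (auto simp: subgraph_def compatible_def)
  then have "copies H G \<subseteq> ?f ` (Pow (verts G) \<times> Pow (arcs G))"
    by (auto simp: copies_def)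
  then show ?thesis
    by (rule finite_subset) simp
qed

end

theory Submission
  imports Defs
begin

text \<open>
  Let \<open>N(H)\<close> be the number of embeddings of \<open>H\<close> into \<open>T\<close> and
  \<open>D(H) = N(H) - N(H\<inverse>)\<close>. An embedding of \<open>H - uv\<close> embeds exactly one of \<open>H\<close> and
  \<open>H\<close> with \<open>uv\<close> reversed, so by induction on the number of arcs reversing a single arc of \<open>H\<close> negates
  \<open>D(H)\<close>. Hence \<open>\<bar>D(H)\<bar>\<close> depends on the underlying graph of \<open>H\<close> only. This graph is a disjoint
  union of paths and cycles and thus has an orientation isomorphic to its own converse, namely
  the one directing every path and every cycle consistently; for it \<open>D\<close> vanishes. Finally,
  \<open>N(H)\<close> is the number of copies of \<open>H\<close> times the number of automorphisms of \<open>H\<close>.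
\<close>

section \<open>Embeddings into tournaments\<close>

text \<open>Digraphs enter as relations, so that single arcs can be inserted, deleted and reversed
  by set operations. Extensionality makes every embedding count exactly once.\<close>

definition embeddings ::
  "'c set \<Rightarrow> ('c \<times> 'c) set \<Rightarrow> 'a set \<Rightarrow> ('a \<times> 'a) set \<Rightarrow> ('c \<Rightarrow> 'a) set" where
  "embeddings V R W A = {f \<in> V \<rightarrow>\<^sub>E W. inj_on f V \<and> (\<forall>(x, y) \<in> R. (f x, f y) \<in> A)}"

lemma embeddingsI:
  assumes "f \<in> V \<rightarrow>\<^sub>E W" "inj_on f V" "\<And>x y. (x, y) \<in> R \<Longrightarrow> (f x, f y) \<in> A"
  shows "f \<in> embeddings V R W A"
  using assms by (auto simp: embeddings_def)

lemma embeddingsD: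
  assumes "f \<in> embeddings V R W A"
  shows "f \<in> V \<rightarrow>\<^sub>E W" "inj_on f V" "\<And>x y. (x, y) \<in> R \<Longrightarrow> (f x, f y) \<in> A"
  using assms by (auto simp: embeddings_def)

lemma finite_embeddings:
  assumes "finite V" "finite W"
  shows "finite (embeddings V R W A)"
  by (rule finite_subset[OF _ finite_PiE[of V "\<lambda>_. W"]]) (auto simp: embeddings_def assms)

text \<open>Trades reversal of the tournament for reversal of the pattern, so that the tournament
  stays fixed in the induction.\<close>

lemma embeddings_converse: "embeddings V R W (A\<inverse>) = embeddings V (R\<inverse>) W A"
  by (auto simp: embeddings_def)

locale finite_tournament_relation =
  fixes W :: "'a set" and A :: "('a \<times> 'a) set"
  assumes finite_W: "finite W"
    and one_direction: "\<lbrakk>u \<in> W; v \<in> W; u \<noteq> v\<rbrakk> \<Longrightarrow> (u, v) \<in> A \<longleftrightarrow> (v, u) \<notin> A"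
begin

text \<open>By injectivity \<open>u\<close> and \<open>v\<close> have distinct images, and the
  tournament has exactly one of the two arcs between them.\<close>

lemma card_embeddings_insert:
  assumes "finite V" "u \<in> V" "v \<in> V" "u \<noteq> v"
  shows "card (embeddings V (insert (u, v) R) W A) + card (embeddings V (insert (v, u) R) W A)
    = card (embeddings V R W A)"
proof -
  have dir: "(f u, f v) \<in> A \<longleftrightarrow> (f v, f u) \<notin> A" if "f \<in> embeddings V R W A" for f
    using that assms by (intro one_direction) (auto simp: embeddings_def inj_on_def)
  have "embeddings V R W A
      = embeddings V (insert (u, v) R) W A \<union> embeddings V (insert (v, u) R) W A"
    using dir by (auto simp: embeddings_def)
  moreover have "embeddings V (insert (u, v) R) W A \<inter> embeddings V (insert (v, u) R) W A = {}"
    using dir by (auto simp: embeddings_def)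
  ultimately show ?thesis
    by (simp add: card_Un_disjoint finite_embeddings assms finite_W)
qed

text \<open>Disposes of patterns with a directed 2-cycle, which are not orientations of a simple
  graph and escape the reversal argument.\<close>

lemma embeddings_antiparallel:
  assumes "(u, v) \<in> R" "(v, u) \<in> R" "u \<in> V" "v \<in> V" "u \<noteq> v"
  shows "embeddings V R W A = {}"
proof -
  have False if "f \<in> embeddings V R W A" for f
  proof -
    have "f u \<in> W" "f v \<in> W" "f u \<noteq> f v" "(f u, f v) \<in> A" "(f v, f u) \<in> A"
      using that assms by (auto simp: embeddings_def inj_on_def)
    then show False using one_direction by blast
  qed
  then show ?thesis by auto
qed

end

section \<open>Self-converse orientations\<close>

text \<open>The map \<open>\<phi>\<close> is an anti-automorphism of \<open>Q\<close>. Asking for an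
  involution supplies bijectivity on \<open>V\<close> and lets the map be its own inverse.\<close>

definition has_self_converse_orientation :: "'c set \<Rightarrow> ('c \<times> 'c) set \<Rightarrow> bool" where
  "has_self_converse_orientation V E \<longleftrightarrow> (\<exists>Q \<phi>. Q \<subseteq> V \<times> V \<and> asym Q \<and> E = Q \<union> Q\<inverse>
    \<and> (\<forall>x\<in>V. \<phi> x \<in> V \<and> \<phi> (\<phi> x) = x) \<and> (\<forall>(x, y)\<in>Q. (\<phi> y, \<phi> x) \<in> Q))"

text \<open>Anti-automorphisms on disjoint vertex sets glue together, so the orientation can be
  built one component at a time.\<close>

lemma has_self_converse_orientation_Un:
  assumes "has_self_converse_orientation V E" "has_self_converse_orientation V' E'" "V \<inter> V' = {}"
  shows "has_self_converse_orientation (V \<union> V') (E \<union> E')"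
proof -
  obtain Q \<phi> where Q: "Q \<subseteq> V \<times> V" "asym Q" "E = Q \<union> Q\<inverse>"
      "\<forall>x\<in>V. \<phi> x \<in> V \<and> \<phi> (\<phi> x) = x" "\<forall>(x, y)\<in>Q. (\<phi> y, \<phi> x) \<in> Q"
    using assms(1) unfolding has_self_converse_orientation_def by (elim exE conjE)
  obtain Q' \<phi>' where Q': "Q' \<subseteq> V' \<times> V'" "asym Q'" "E' = Q' \<union> Q'\<inverse>"
      "\<forall>x\<in>V'. \<phi>' x \<in> V' \<and> \<phi>' (\<phi>' x) = x" "\<forall>(x, y)\<in>Q'. (\<phi>' y, \<phi>' x) \<in> Q'"
    using assms(2) unfolding has_self_converse_orientation_def by (elim exE conjE)
  define \<psi> where "\<psi> x = (if x \<in> V then \<phi> x else \<phi>' x)" for x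
  have [simp]: "x \<in> V \<Longrightarrow> \<psi> x = \<phi> x" "x \<in> V' \<Longrightarrow> \<psi> x = \<phi>' x" for x
    using assms(3) by (auto simp: \<psi>_def)
  show ?thesis
    unfolding has_self_converse_orientation_def
  proof (intro exI conjI)
    show "Q \<union> Q' \<subseteq> (V \<union> V') \<times> (V \<union> V')" using Q(1) Q'(1) by blast
    show "asym (Q \<union> Q')"
      using Q(1,2) Q'(1,2) assms(3) by (auto simp: asym_iff)
    show "E \<union> E' = (Q \<union> Q') \<union> (Q \<union> Q')\<inverse>" using Q(3) Q'(3) by blast
    show "\<forall>x\<in>V \<union> V'. \<psi> x \<in> V \<union> V' \<and> \<psi> (\<psi> x) = x" using Q(4) Q'(4) by auto
    show "\<forall>(x, y)\<in>Q \<union> Q'. (\<psi> y, \<psi> x) \<in> Q \<union> Q'"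
    proof -
      have "(\<psi> y, \<psi> x) \<in> Q" if "(x, y) \<in> Q" for x y
      proof -
        have "x \<in> V" "y \<in> V" "(\<phi> y, \<phi> x) \<in> Q" using that Q(1,5) by blast+
        then show ?thesis by simp
      qed
      moreover have "(\<psi> y, \<psi> x) \<in> Q'" if "(x, y) \<in> Q'" for x y
      proof -
        have "x \<in> V'" "y \<in> V'" "(\<phi>' y, \<phi>' x) \<in> Q'" using that Q'(1,5) by blast+
        then show ?thesis by simp
      qed
      ultimately show ?thesis by blast
    qed
  qed
qed

text \<open>A longest path works: a neighbour of an end off the path would extend it. Lengths are
  bounded by \<open>card V\<close> because the vertices are distinct.\<close>

lemma maximal_path_exists:
  assumes "finite V" "v \<in> V"
  obtains p where "p \<noteq> []" "set p \<subseteq> V" "distinct p" "successively (\<lambda>x y. (x, y) \<in> E) p"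
    "\<And>w. \<lbrakk>w \<in> V; (w, hd p) \<in> E\<rbrakk> \<Longrightarrow> w \<in> set p" "\<And>w. \<lbrakk>w \<in> V; (last p, w) \<in> E\<rbrakk> \<Longrightarrow> w \<in> set p"
proof -
  define P where
    "P p \<longleftrightarrow> p \<noteq> [] \<and> set p \<subseteq> V \<and> distinct p \<and> successively (\<lambda>x y. (x, y) \<in> E) p" for p
  have "P [v]" using assms by (simp add: P_def)
  moreover have "\<forall>p. P p \<longrightarrow> length p < Suc (card V)"
    using assms(1) unfolding P_def by (metis card_mono distinct_card less_Suc_eq_le)
  ultimately obtain p where p: "P p" and max: "\<And>q. P q \<Longrightarrow> length q \<le> length p"
    using ex_has_greatest_nat[of P "[v]" length "Suc (card V)"] by blast
  note p = p[unfolded P_def] and max = max[unfolded P_def]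
  show thesis
  proof (rule that)
    show "w \<in> set p" if "w \<in> V" "(w, hd p) \<in> E" for w
      using max[of "w # p"] p that by (auto simp: successively_Cons)
    show "w \<in> set p" if "w \<in> V" "(last p, w) \<in> E" for w
      using max[of "p @ [w]"] p that by (auto simp: successively_append_iff)
  qed (use p in auto)
qed

context
  fixes V :: "'c set" and E :: "('c \<times> 'c) set"
  assumes finite_V: "finite V" and E_V: "E \<subseteq> V \<times> V" and sym_E: "sym E" and irrefl_E: "irrefl E"
    and degree_le_2: "\<And>v. v \<in> V \<Longrightarrow> card (E `` {v}) \<le> 2"
begin

lemma two_neighbours:
  assumes "(v, a) \<in> E" "(v, b) \<in> E" "(v, w) \<in> E" "a \<noteq> b"
  shows "w = a \<or> w = b"
proof (rule ccontr)
  assume "\<not> (w = a \<or> w = b)"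
  then have "card {a, b, w} = 3" using assms(4) by auto
  moreover have "{a, b, w} \<subseteq> E `` {v}" using assms by auto
  moreover have "finite (E `` {v})" using finite_V E_V by (meson finite_Image finite_SigmaI finite_subset)
  ultimately have "3 \<le> card (E `` {v})" by (metis card_mono)
  then show False using degree_le_2[of v] assms(1) E_V by auto
qed

text \<open>
  Inner vertices of \<open>p\<close> have both their neighbours on \<open>p\<close>, and by maximality so do the ends.
  Hence the only possible edge that is not a step of \<open>p\<close> joins its two ends.
\<close>

lemma maximal_path_component:
  assumes p: "p \<noteq> []" "set p \<subseteq> V" "distinct p" "successively (\<lambda>x y. (x, y) \<in> E) p"
    and left: "\<And>w. \<lbrakk>w \<in> V; (w, hd p) \<in> E\<rbrakk> \<Longrightarrow> w \<in> set p"
    and right: "\<And>w. \<lbrakk>w \<in> V; (last p, w) \<in> E\<rbrakk> \<Longrightarrow> w \<in> set p"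
  shows "E `` set p \<subseteq> set p" "has_self_converse_orientation (set p) (E \<inter> set p \<times> set p)"
proof -
  define n where "n = length p"
  have n: "n > 0" using p(1) by (simp add: n_def)
  have inj: "p ! i = p ! j \<longleftrightarrow> i = j" if "i < n" "j < n" for i j
    using that p(3) by (simp add: nth_eq_iff_index_eq n_def)
  have step: "(p ! i, p ! Suc i) \<in> E" if "Suc i < n" for i
    using p(4) that by (simp add: successively_conv_nth n_def)
  have step': "(p ! Suc i, p ! i) \<in> E" if "Suc i < n" for i
    using step[OF that] sym_E by (auto dest: symD)
  \<comment> \<open>The two path neighbours of an inner vertex are distinct, so they exhaust its
    degree.\<close>
  have interior: "w = p ! i \<or> w = p ! Suc (Suc i)"
    if "Suc (Suc i) < n" "(p ! Suc i, w) \<in> E" for i w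
    using that step[of "Suc i"] step'[of i] inj[of i "Suc (Suc i)"]
    by (intro two_neighbours[of "p ! Suc i"]) auto
  have set_p: "set p = (!) p ` {..<n}"
    by (auto simp: set_conv_nth n_def)
  show "E `` set p \<subseteq> set p"
  proof
    fix w assume "w \<in> E `` set p"
    then obtain i where i: "i < n" "(p ! i, w) \<in> E" by (auto simp: set_p)
    then have w: "w \<in> V" using E_V by auto
    consider "i = 0" | "i = n - 1" | j where "i = Suc j" "Suc (Suc j) < n"
      using i(1) by (cases i) fastforce+
    then show "w \<in> set p"
    proof cases
      case 1
      then have "(w, hd p) \<in> E" using i sym_E p(1) by (auto simp: hd_conv_nth dest: symD)
      then show ?thesis using left w by blast
    next
      case 2
      then have "(last p, w) \<in> E" using i p(1) by (simp add: last_conv_nth n_def)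
      then show ?thesis using right w by blast
    next
      case 3
      then show ?thesis using interior[of j w] i by (auto simp: set_p)
    qed
  qed
  have arcs: "j = Suc i \<or> i = 0 \<and> j = n - 1" if ij: "i < j" "j < n" "(p ! i, p ! j) \<in> E" for i j
  proof (cases i)
    case (Suc i')
    then show ?thesis using interior[of i' "p ! j"] ij inj by auto
  next
    case 0
    show ?thesis
    proof (rule ccontr)
      assume "\<not> ?thesis"
      \<comment> \<open>Here \<open>p ! j\<close> is an inner vertex and \<open>j\<close> is not 1,
        so \<open>p ! 0\<close> would be a third neighbour of it.\<close>
      then obtain j' where j: "j = Suc j'" "Suc j < n" "j' \<noteq> 0" using ij 0 by (cases j) auto
      then have "(p ! Suc j', p ! 0) \<in> E" using ij 0 sym_E by (auto dest: symD)
      then show False using interior[of j' "p ! 0"] j inj[of 0] by auto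
    qed
  qed
  \<comment> \<open>Paths and cycles are treated at once: the closing arc is present only if it lies
    in \<open>E\<close>. The bound \<open>n > 2\<close> matters since for \<open>n = 2\<close> the
    closing arc would reverse the only step and spoil asymmetry.\<close>
  define Q where "Q = {(p ! i, p ! Suc i) | i. Suc i < n}
    \<union> {a \<in> E. a = (p ! (n - 1), p ! 0) \<and> n > 2}"
  define ix where "ix = the_inv_into {..<n} ((!) p)"
  have ix: "ix (p ! i) = i" if "i < n" for i
    using that inj unfolding ix_def by (intro the_inv_into_f_f) (auto simp: inj_on_def)
  \<comment> \<open>Reflection of the path, sending position \<open>i\<close> to
    \<open>n - 1 - i\<close>. It reverses the steps and swaps the ends of the closing arc.\<close>
  define \<phi> where "\<phi> x = p ! (n - 1 - ix x)" for x
  have \<phi>: "\<phi> (p ! i) = p ! (n - 1 - i)" if "i < n" for i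
    using that by (simp add: \<phi>_def ix)
  show "has_self_converse_orientation (set p) (E \<inter> set p \<times> set p)"
    unfolding has_self_converse_orientation_def
  proof (intro exI conjI)
    show Q_p: "Q \<subseteq> set p \<times> set p"
      using n by (auto simp: Q_def set_p)
    show "asym Q"
      using n by (auto simp: asym_iff Q_def inj)
    show "E \<inter> set p \<times> set p = Q \<union> Q\<inverse>"
    proof
      have Q_E: "Q \<subseteq> E" using step by (auto simp: Q_def)
      then have "Q\<inverse> \<subseteq> E" using sym_E by (auto dest: symD)
      then show "Q \<union> Q\<inverse> \<subseteq> E \<inter> set p \<times> set p" using Q_E Q_p by auto
      have less: "(p ! i, p ! j) \<in> Q \<union> Q\<inverse>" if "i < j" "j < n" "(p ! i, p ! j) \<in> E" for i j
      proof (cases "j = Suc i")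
        case True
        then show ?thesis using that by (auto simp: Q_def)
      next
        case False
        then have "i = 0" "j = n - 1" "n > 2" using arcs[OF that] that by auto
        then show ?thesis using that sym_E by (auto simp: Q_def dest: symD)
      qed
      show "E \<inter> set p \<times> set p \<subseteq> Q \<union> Q\<inverse>"
      proof (rule subrelI)
        fix x y assume "(x, y) \<in> E \<inter> set p \<times> set p"
        then obtain i j where ij: "x = p ! i" "i < n" "y = p ! j" "j < n" "(p ! i, p ! j) \<in> E"
            "(p ! j, p ! i) \<in> E"
          using sym_E by (auto simp: set_p dest: symD)
        then have "i \<noteq> j" using irrefl_E by (auto simp: irrefl_def)
        then show "(x, y) \<in> Q \<union> Q\<inverse>"
          using less[of i j] less[of j i] ij by (cases i j rule: linorder_cases) auto
      qed
    qed
    show "\<forall>x\<in>set p. \<phi> x \<in> set p \<and> \<phi> (\<phi> x) = x"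
      using n by (auto simp: set_p \<phi>)
    show "\<forall>(x, y)\<in>Q. (\<phi> y, \<phi> x) \<in> Q"
    proof clarify
      fix x y assume "(x, y) \<in> Q"
      then consider i where "x = p ! i" "y = p ! Suc i" "Suc i < n"
        | "x = p ! (n - 1)" "y = p ! 0" "n > 2" "(p ! (n - 1), p ! 0) \<in> E"
        by (auto simp: Q_def)
      then show "(\<phi> y, \<phi> x) \<in> Q"
      proof cases
        case 1
        \<comment> \<open>The step starting at \<open>i\<close> is sent to the step starting at
          \<open>n - 1 - Suc i\<close>; the truncated subtraction is harmless because
          \<open>Suc i < n\<close>.\<close>
        have "n - 1 - i = Suc (n - 1 - Suc i)" using 1(3) by simp
        then show ?thesis using 1 unfolding Q_def
          by (intro UnI1 CollectI exI[of _ "n - 1 - Suc i"]) (simp add: \<phi>)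
      next
        case 2
        then show ?thesis using n by (simp add: \<phi> Q_def)
      qed
    qed
  qed
qed

end

text \<open>A maximal path spans a component. Removing its vertices preserves the degree bound, so
  induction on the vertex set applies to the rest.\<close>

lemma has_self_converse_orientation_if_degree_le_2:
  assumes "finite V" "E \<subseteq> V \<times> V" "sym E" "irrefl E" "\<And>v. v \<in> V \<Longrightarrow> card (E `` {v}) \<le> 2"
  shows "has_self_converse_orientation V E"
  using assms
proof (induction V arbitrary: E rule: finite_psubset_induct)
  case (psubset V)
  show ?case
  proof (cases "V = {}")
    case True
    then show ?thesis using psubset.prems(1)
      by (auto simp: has_self_converse_orientation_def asym_iff)
  next
    case False
    then obtain v where "v \<in> V" by auto
    then obtain p where p: "p \<noteq> []" "set p \<subseteq> V" "distinct p" "successively (\<lambda>x y. (x, y) \<in> E) p"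
      "\<And>w. \<lbrakk>w \<in> V; (w, hd p) \<in> E\<rbrakk> \<Longrightarrow> w \<in> set p" "\<And>w. \<lbrakk>w \<in> V; (last p, w) \<in> E\<rbrakk> \<Longrightarrow> w \<in> set p"
      using maximal_path_exists[OF psubset.hyps, of v E] by blast
    note comp = maximal_path_component[OF psubset.hyps psubset.prems p]
    let ?V' = "V - set p"
    let ?E' = "E \<inter> ?V' \<times> ?V'"
    have "finite (E `` {v})" for v
      using psubset.hyps psubset.prems(1) by (meson finite_Image finite_SigmaI finite_subset)
    then have card_le: "card (?E' `` {v}) \<le> card (E `` {v})" for v
      by (rule card_mono) auto
    have "has_self_converse_orientation ?V' ?E'"
    proof (rule psubset.IH)
      show "?V' \<subset> V" using p(1,2) by (cases p) auto
      show "sym ?E'" using psubset.prems(2) by (auto simp: sym_def)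
      show "irrefl ?E'" using psubset.prems(3) by (auto simp: irrefl_def)
      show "card (?E' `` {v}) \<le> 2" if "v \<in> ?V'" for v
        using card_le[of v] psubset.prems(4)[of v] that by simp
    qed auto
    with comp(2) have "has_self_converse_orientation (set p \<union> ?V') (E \<inter> set p \<times> set p \<union> ?E')"
      by (rule has_self_converse_orientation_Un) auto
    moreover have "set p \<union> ?V' = V" using p(2) by auto
    \<comment> \<open>No edge leaves \<open>set p\<close>, and by symmetry none enters it.\<close>
    moreover have "E \<inter> set p \<times> set p \<union> ?E' = E"
      using comp(1) psubset.prems(1,2) by (auto dest: symD)
    ultimately show ?thesis by simp
  qed
qed

section \<open>Reversing arcs one at a time\<close>

text \<open>Precomposition with \<open>\<phi>\<close> turns embeddings of \<open>Q\<close> into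
  embeddings of its converse and undoes itself; the restriction restores extensionality.\<close>

lemma card_embeddings_self_converse:
  assumes "\<forall>x\<in>V. \<phi> x \<in> V \<and> \<phi> (\<phi> x) = x" "\<forall>(x, y)\<in>Q. (\<phi> y, \<phi> x) \<in> Q"
    "Q \<subseteq> V \<times> V"
  shows "card (embeddings V Q W A) = card (embeddings V (Q\<inverse>) W A)"
proof (rule bij_betw_same_card)
  let ?c = "\<lambda>f. restrict (f \<circ> \<phi>) V"
  have *: "inj_on (?c f) V" if "inj_on f V" for f
    using that assms(1) by (auto simp: inj_on_def) metis
  have inv: "?c (?c f) = f" if "f \<in> V \<rightarrow>\<^sub>E W" for f
    using that assms(1) by (auto intro!: ext simp: restrict_def PiE_def extensional_def)
  show "bij_betw ?c (embeddings V Q W A) (embeddings V (Q\<inverse>) W A)"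
  proof (rule bij_betw_byWitness[where f' = ?c])
    show "\<forall>f\<in>embeddings V Q W A. ?c (?c f) = f" "\<forall>f\<in>embeddings V (Q\<inverse>) W A. ?c (?c f) = f"
      using inv by (auto simp only: embeddings_def mem_Collect_eq)
    have "?c f \<in> embeddings V S' W A"
      if f: "f \<in> embeddings V S W A" and S: "S' \<subseteq> V \<times> V" "\<And>x y. (x, y) \<in> S' \<Longrightarrow> (\<phi> x, \<phi> y) \<in> S"
      for f S S'
    proof -
      have "?c f \<in> V \<rightarrow>\<^sub>E W" "inj_on (?c f) V"
        using f assms(1) * by (auto simp: embeddings_def)
      moreover have "(?c f x, ?c f y) \<in> A" if "(x, y) \<in> S'" for x y
        using S(1) that S(2)[OF that] f by (auto simp: embeddings_def)
      ultimately show ?thesis by (rule embeddingsI)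
    qed
    note * = this
    show "?c ` embeddings V Q W A \<subseteq> embeddings V (Q\<inverse>) W A"
      by (rule image_subsetI, rule *) (use assms(2,3) in auto)
    show "?c ` embeddings V (Q\<inverse>) W A \<subseteq> embeddings V Q W A"
      by (rule image_subsetI, rule *) (use assms(2,3) in auto)
  qed
qed

context finite_tournament_relation
begin

text \<open>Two nested inductions: the outer one, on the number of arcs, shows that a reversal
  negates the difference \<open>D\<close>; the inner one carries \<open>R\<close> by such reversals
  to a self-converse orientation.\<close>

lemma card_embeddings_converse:
  assumes "finite V" "R \<subseteq> V \<times> V" "asym R" "\<And>v. v \<in> V \<Longrightarrow> card ((R \<union> R\<inverse>) `` {v}) \<le> 2"
  shows "card (embeddings V R W A) = card (embeddings V (R\<inverse>) W A)"
  using assms(2-)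
proof (induction "card R" arbitrary: R rule: less_induct)
  case less
  have fin: "finite S" if "S \<subseteq> V \<times> V" for S
    using that assms(1) finite_subset by blast
  define D where "D S = int (card (embeddings V S W A)) - int (card (embeddings V (S\<inverse>) W A))" for S
  \<comment> \<open>Fixing the number of arcs keeps the outer induction hypothesis available after
    any number of reversals: deleting an arc of \<open>S\<close> leaves fewer arcs than
    \<open>R\<close> has.\<close>
  define orientation where
    "orientation S \<longleftrightarrow> S \<subseteq> V \<times> V \<and> asym S \<and> S \<union> S\<inverse> = R \<union> R\<inverse> \<and> card S = card R" for S
  have flip: "D (insert (v, u) (S - {(u, v)})) = - D S \<and> orientation (insert (v, u) (S - {(u, v)}))"
    if S: "orientation S" and uv: "(u, v) \<in> S" for S u v
  proof
    let ?S = "S - {(u, v)}"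
    have S_V: "S \<subseteq> V \<times> V" and asym: "asym S" and un: "S \<union> S\<inverse> = R \<union> R\<inverse>" and card: "card S = card R"
      using S by (auto simp: orientation_def)
    have finS: "finite S" using S_V by (rule fin)
    have uv': "u \<in> V" "v \<in> V" "u \<noteq> v" "(v, u) \<notin> S"
      using uv S_V asym by (auto simp: asym_iff)
    have "card (embeddings V ?S W A) = card (embeddings V (?S\<inverse>) W A)"
    proof (rule less.hyps)
      show "card ?S < card R"
        using uv finS by (simp only: card[symmetric] card_Diff1_less)
      show "?S \<subseteq> V \<times> V" "asym ?S" using S_V asym by (auto simp: asym_iff)
      show "card ((?S \<union> ?S\<inverse>) `` {w}) \<le> 2" if "w \<in> V" for w
      proof -
        have "card ((?S \<union> ?S\<inverse>) `` {w}) \<le> card ((S \<union> S\<inverse>) `` {w})"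
          using finS by (intro card_mono finite_Image) auto
        then show ?thesis using less.prems(3)[OF that] un by simp
      qed
    qed
    moreover have "insert (u, v) ?S = S" using uv by auto
    moreover have "(insert (v, u) ?S)\<inverse> = insert (u, v) (?S\<inverse>)" "S\<inverse> = insert (v, u) (?S\<inverse>)"
      using uv by auto
    \<comment> \<open>With \<open>N\<close> the number of embeddings and \<open>S'\<close> the
      reoriented \<open>S\<close>, both \<open>N(S) + N(S')\<close> and the same sum for the
      converses count embeddings of \<open>?S\<close> and of its converse, which agree by
      induction.\<close>
    ultimately show "D (insert (v, u) ?S) = - D S"
      using card_embeddings_insert[OF assms(1) uv'(1-3), of ?S]
        card_embeddings_insert[OF assms(1) uv'(1-3), of "?S\<inverse>"]
      unfolding D_def by simp
    show "orientation (insert (v, u) ?S)"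
      unfolding orientation_def
    proof (intro conjI)
      show "insert (v, u) ?S \<subseteq> V \<times> V" using S_V uv' by auto
      show "asym (insert (v, u) ?S)" using asym uv' by (auto simp: asym_iff)
      show "insert (v, u) ?S \<union> (insert (v, u) ?S)\<inverse> = R \<union> R\<inverse>" using uv un by blast
      show "card (insert (v, u) ?S) = card R"
        using uv uv' finS card by (metis DiffD1 card.insert_remove card_Suc_Diff1 card_insert_disjoint finite_Diff)
    qed
  qed
  have "has_self_converse_orientation V (R \<union> R\<inverse>)"
    using less.prems assms(1)
    by (intro has_self_converse_orientation_if_degree_le_2)
      (auto simp: sym_def irrefl_def asym_iff)
  then obtain Q \<phi> where Q: "Q \<subseteq> V \<times> V" "asym Q" "R \<union> R\<inverse> = Q \<union> Q\<inverse>"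
      "\<forall>x\<in>V. \<phi> x \<in> V \<and> \<phi> (\<phi> x) = x" "\<forall>(x, y)\<in>Q. (\<phi> y, \<phi> x) \<in> Q"
    unfolding has_self_converse_orientation_def by (elim exE conjE)
  have "D Q = 0"
    using card_embeddings_self_converse[of V \<phi> Q W A] Q(1,4,5) by (simp add: D_def)
  \<comment> \<open>Induction on the number of arcs on which \<open>S\<close> disagrees with
    \<open>Q\<close>. Reversing one of them removes a disagreement and only changes the sign of
    \<open>D\<close>.\<close>
  have "D S = 0" if "orientation S" for S
    using that
  proof (induction "card (S - Q)" arbitrary: S rule: less_induct)
    case (less S)
    have S: "S \<subseteq> V \<times> V" "asym S" "S \<union> S\<inverse> = Q \<union> Q\<inverse>"
      using less.prems Q(3) by (auto simp: orientation_def)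
    show ?case
    proof (cases "S \<subseteq> Q")
      case True
      \<comment> \<open>Both orient the same graph, so inclusion forces equality.\<close>
      then have "S = Q" using S(3) Q(2) by (fastforce simp: asym_iff)
      then show ?thesis using \<open>D Q = 0\<close> by simp
    next
      case False
      then obtain u v where uv: "(u, v) \<in> S" "(u, v) \<notin> Q" by auto
      then have "(v, u) \<in> Q" using S(3) by blast
      then have "insert (v, u) (S - {(u, v)}) - Q = S - Q - {(u, v)}" by auto
      moreover have "card (S - Q - {(u, v)}) < card (S - Q)"
        using uv fin[OF S(1)] by (intro card_Diff1_less) auto
      ultimately show ?thesis
        using less.hyps[of "insert (v, u) (S - {(u, v)})"] flip[OF less.prems uv(1)] by simp
    qed
  qed
  then have "D R = 0" using less.prems by (simp add: orientation_def)
  then show ?case by (simp add: D_def)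
qed

end

section \<open>Copies and embeddings\<close>

text \<open>Arcs of \<open>T\<close> are abstract, so the image arcs are selected by their ends;
  without parallel arcs in \<open>T\<close>, each image pair selects at most one arc.\<close>

definition image_digraph ::
  "('c, 'd) pre_digraph \<Rightarrow> ('a, 'b) pre_digraph \<Rightarrow> ('c \<Rightarrow> 'a) \<Rightarrow> ('a, 'b) pre_digraph" where
  "image_digraph H T f = \<lparr>verts = f ` verts H,
    arcs = {a \<in> arcs T. arc_to_ends T a \<in> map_prod f f ` arcs_ends H}, tail = tail T, head = head T\<rparr>"

abbreviation digraph_embeddings ::
  "('c, 'd) pre_digraph \<Rightarrow> ('a, 'b) pre_digraph \<Rightarrow> ('c \<Rightarrow> 'a) set" where
  "digraph_embeddings H T \<equiv> embeddings (verts H) (arcs_ends H) (verts T) (arcs_ends T)"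

lemma (in wf_digraph) arcs_ends_subset: "arcs_ends G \<subseteq> verts G \<times> verts G"
  by (auto simp: arcs_ends_conv)

text \<open>All image pairs are ends of arcs of \<open>T\<close>, so the selected arcs determine the
  set of image pairs.\<close>

lemma image_digraph_eq_iff:
  assumes "f \<in> digraph_embeddings H T" "g \<in> digraph_embeddings H T"
  shows "image_digraph H T f = image_digraph H T g \<longleftrightarrow>
    f ` verts H = g ` verts H \<and> map_prod f f ` arcs_ends H = map_prod g g ` arcs_ends H"
proof -
  have ends: "X = arc_to_ends T ` {a \<in> arcs T. arc_to_ends T a \<in> X}" if "X \<subseteq> arcs_ends T" for X
    using that unfolding arcs_ends_def by blast
  have "map_prod f f ` arcs_ends H \<subseteq> arcs_ends T" "map_prod g g ` arcs_ends H \<subseteq> arcs_ends T"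
    using assms by (auto simp: embeddings_def)
  note ends = this[THEN ends]
  show ?thesis
  proof
    assume "image_digraph H T f = image_digraph H T g"
    then have "f ` verts H = g ` verts H"
      and "{a \<in> arcs T. arc_to_ends T a \<in> map_prod f f ` arcs_ends H}
        = {a \<in> arcs T. arc_to_ends T a \<in> map_prod g g ` arcs_ends H}"
      by (simp_all add: image_digraph_def)
    then show "f ` verts H = g ` verts H \<and> map_prod f f ` arcs_ends H = map_prod g g ` arcs_ends H"
      using ends by metis
  qed (simp add: image_digraph_def)
qed

lemma image_digraph_in_copies:
  assumes "digraph H" "digraph T" "f \<in> digraph_embeddings H T"
  shows "image_digraph H T f \<in> copies H T"
proof -
  interpret H: digraph H by fact
  interpret T: digraph T by fact
  have f: "f ` verts H \<subseteq> verts T" "inj_on f (verts H)"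
    using assms(3) by (auto simp: embeddings_def)
  have "\<exists>b. b \<in> arcs T \<and> arc_to_ends T b = (f (tail H a), f (head H a))" if "a \<in> arcs H" for a
  proof -
    have "(f (tail H a), f (head H a)) \<in> arcs_ends T"
      using assms(3) that by (auto simp: embeddings_def arcs_ends_conv)
    then show ?thesis by (auto simp: arcs_ends_def)
  qed
  \<comment> \<open>Choosing an arc of \<open>T\<close> over each image pair gives the arc part of
    the isomorphism.\<close>
  then obtain g where g: "\<And>a. a \<in> arcs H \<Longrightarrow> g a \<in> arcs T"
      "\<And>a. a \<in> arcs H \<Longrightarrow> arc_to_ends T (g a) = (f (tail H a), f (head H a))"
    by metis
  then have tail_head: "tail T (g a) = f (tail H a)" "head T (g a) = f (head H a)"
    if "a \<in> arcs H" for a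
    using that by (auto simp: arc_to_ends_def)
  let ?h = "\<lparr>iso_verts = f, iso_arcs = g, iso_head = head T, iso_tail = tail T\<rparr>"
  have "inj_on g (arcs H)"
  proof (rule inj_onI)
    fix a b assume ab: "a \<in> arcs H" "b \<in> arcs H" "g a = g b"
    then have "tail H a = tail H b" "head H a = head H b"
      using tail_head f(2) by (metis H.tail_in_verts inj_onD, metis H.head_in_verts inj_onD)
    then show "a = b" using H.no_multi_arcs ab by (simp add: arc_to_ends_def)
  qed
  then have "H.digraph_isomorphism ?h"
    using f tail_head H.wf_digraph by (simp add: H.digraph_isomorphism_def)
  moreover have "image_digraph H T f = app_iso ?h H"
  proof (rule pre_digraph.equality)
    show "arcs (image_digraph H T f) = arcs (app_iso ?h H)"
    proof
      show "arcs (app_iso ?h H) \<subseteq> arcs (image_digraph H T f)"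
      proof
        fix b assume "b \<in> arcs (app_iso ?h H)"
        then obtain a where a: "a \<in> arcs H" "b = g a" by auto
        then have "arc_to_ends T b = map_prod f f (arc_to_ends H a)"
          using g(2) by (simp add: arc_to_ends_def)
        then show "b \<in> arcs (image_digraph H T f)"
          using a g(1) by (simp add: image_digraph_def arcs_ends_def)
      qed
      show "arcs (image_digraph H T f) \<subseteq> arcs (app_iso ?h H)"
      proof
        fix b assume "b \<in> arcs (image_digraph H T f)"
        then obtain a where "b \<in> arcs T" "a \<in> arcs H" "arc_to_ends T b = arc_to_ends T (g a)"
          using g(2) by (auto simp: image_digraph_def arcs_ends_conv)
        then show "b \<in> arcs (app_iso ?h H)"
          using T.no_multi_arcs[of b "g a"] g(1) by auto
      qed
    qed
  qed (simp_all add: image_digraph_def)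
  ultimately have "digraph_iso H (image_digraph H T f)"
    unfolding digraph_iso_def by blast
  moreover have "subgraph (image_digraph H T f) T"
    unfolding subgraph_def
  proof (intro conjI)
    show "wf_digraph (image_digraph H T f)"
    proof
      fix b assume "b \<in> arcs (image_digraph H T f)"
      then obtain a where "a \<in> arcs H" "tail T b = f (tail H a)" "head T b = f (head H a)"
        by (auto simp: image_digraph_def arcs_ends_conv arc_to_ends_def)
      then show "tail (image_digraph H T f) b \<in> verts (image_digraph H T f)"
        "head (image_digraph H T f) b \<in> verts (image_digraph H T f)"
        by (auto simp: image_digraph_def)
    qed
  qed (use f(1) T.wf_digraph in \<open>auto simp: image_digraph_def compatible_def\<close>)
  ultimately show ?thesis by (simp add: copies_def)
qed

lemma copies_eq_image_digraph:
  assumes "digraph H" "digraph T" "S \<in> copies H T"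
  obtains f where "f \<in> digraph_embeddings H T" "image_digraph H T f = S"
proof -
  interpret H: digraph H by fact
  interpret T: digraph T by fact
  obtain h where sub: "subgraph S T" and h: "H.digraph_isomorphism h" and S: "S = app_iso h H"
    using assms(3) by (auto simp: copies_def digraph_iso_def)
  let ?f = "restrict (iso_verts h) (verts H)"
  have tail_head: "iso_tail h = tail T" "iso_head h = head T"
    and S_T: "iso_verts h ` verts H \<subseteq> verts T" "iso_arcs h ` arcs H \<subseteq> arcs T"
    using sub by (auto simp: S subgraph_def compatible_def)
  have ends: "arc_to_ends T (iso_arcs h a) = (iso_verts h (tail H a), iso_verts h (head H a))"
    if "a \<in> arcs H" for a
    using H.iso_verts_tail[OF h that] H.iso_verts_head[OF h that]
    by (simp add: arc_to_ends_def tail_head)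
  show thesis
  proof (rule that)
    have "(?f x, ?f y) \<in> arcs_ends T" if xy: "(x, y) \<in> arcs_ends H" for x y
    proof -
      obtain a where "a \<in> arcs H" "x = tail H a" "y = head H a"
        using xy by (auto simp: arcs_ends_conv)
      then show ?thesis
        using ends[of a] S_T(2) unfolding arcs_ends_def
        by (intro image_eqI[of _ _ "iso_arcs h a"]) auto
    qed
    then show "?f \<in> digraph_embeddings H T"
      using H.digraph_isomorphism_inj_on_verts[OF h] S_T(1)
      by (intro embeddingsI) (auto simp: inj_on_restrict_eq)
    have im: "map_prod ?f ?f ` arcs_ends H = arc_to_ends T ` iso_arcs h ` arcs H"
      using ends by (force simp: arcs_ends_conv image_image)
    \<comment> \<open>Absence of parallel arcs makes \<open>arc_to_ends T\<close> injective on the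
      arcs of \<open>T\<close>.\<close>
    have mem: "arc_to_ends T b \<in> arc_to_ends T ` iso_arcs h ` arcs H \<longleftrightarrow> b \<in> iso_arcs h ` arcs H"
      if "b \<in> arcs T" for b
      using T.no_multi_arcs that S_T(2)
      by (intro inj_on_image_mem_iff[of _ "arcs T"] inj_onI)
    have "{b \<in> arcs T. arc_to_ends T b \<in> map_prod ?f ?f ` arcs_ends H}
        = {b \<in> arcs T. b \<in> iso_arcs h ` arcs H}"
      by (simp only: im mem cong: conj_cong)
    also have "\<dots> = iso_arcs h ` arcs H" using S_T(2) by blast
    finally show "image_digraph H T ?f = S"
      unfolding S image_digraph_def by (intro pre_digraph.equality) (simp_all add: tail_head)
  qed
qed

text \<open>By finiteness an injective endomorphism is an automorphism; hence the embeddings of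
  \<open>H\<close> into itself count its automorphisms.\<close>

lemma embeddings_self_surj:
  assumes "finite V" "R \<subseteq> V \<times> V" "h \<in> embeddings V R V R"
  shows "h ` V = V" "map_prod h h ` R = R"
proof -
  have h: "h ` V \<subseteq> V" "inj_on h V" "map_prod h h ` R \<subseteq> R"
    using assms(3) by (auto simp: embeddings_def)
  show "h ` V = V" using endo_inj_surj[OF assms(1)] h by blast
  have "inj_on (map_prod h h) R"
    by (rule inj_on_subset[OF map_prod_inj_on[OF h(2) h(2)] assms(2)])
  moreover have "finite R" using finite_subset[OF assms(2)] assms(1) by simp
  ultimately show "map_prod h h ` R = R" using endo_inj_surj h(3) by metis
qed

text \<open>Embeddings with the same image as \<open>f\<close> are exactly the maps \<open>f\<close>
  after an automorphism \<open>h\<close> of \<open>H\<close>; the automorphism is recovered by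
  applying the inverse of \<open>f\<close>.\<close>

lemma card_image_digraph_fibre:
  assumes "digraph H" "f \<in> digraph_embeddings H T"
  shows "card {g \<in> digraph_embeddings H T. image_digraph H T g = image_digraph H T f}
    = card (digraph_embeddings H H)"
proof -
  interpret H: digraph H by fact
  let ?V = "verts H" and ?R = "arcs_ends H"
  have R_V: "?R \<subseteq> ?V \<times> ?V" by (rule H.arcs_ends_subset)
  have f: "f \<in> ?V \<rightarrow>\<^sub>E verts T" "inj_on f ?V" "\<And>x y. (x, y) \<in> ?R \<Longrightarrow> (f x, f y) \<in> arcs_ends T"
    using embeddingsD[OF assms(2)] by blast+
  let ?k = "inv_into ?V f"
  let ?fibre = "{g \<in> digraph_embeddings H T. image_digraph H T g = image_digraph H T f}"
  have kf: "?k (f x) = x" if "x \<in> ?V" for x using f(2) that by simp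
  have fk: "f (?k y) = y" "?k y \<in> ?V" if "y \<in> f ` ?V" for y
    using that by (simp_all add: f_inv_into_f inv_into_into)
  have fibre: "g ` ?V = f ` ?V" "map_prod g g ` ?R = map_prod f f ` ?R" if "g \<in> ?fibre" for g
    using image_digraph_eq_iff[of g H T f] that assms(2) by auto
  have "bij_betw (\<lambda>h. compose ?V f h) (digraph_embeddings H H) ?fibre"
  proof (rule bij_betw_byWitness[where f' = "\<lambda>g. compose ?V ?k g"])
    show "\<forall>h\<in>digraph_embeddings H H. compose ?V ?k (compose ?V f h) = h"
    proof
      fix h assume h: "h \<in> digraph_embeddings H H"
      show "compose ?V ?k (compose ?V f h) = h"
        using embeddingsD(1)[OF h] kf
        by (intro extensionalityI[of _ ?V]) (auto simp: compose_def PiE_iff)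
    qed
    show "\<forall>g\<in>?fibre. compose ?V f (compose ?V ?k g) = g"
    proof
      fix g assume g: "g \<in> ?fibre"
      then have "g \<in> ?V \<rightarrow>\<^sub>E verts T" using embeddingsD(1) by blast
      moreover have "f (?k (g x)) = g x" if "x \<in> ?V" for x
        using fk(1)[of "g x"] fibre(1)[OF g] that by blast
      ultimately show "compose ?V f (compose ?V ?k g) = g"
        by (intro extensionalityI[of _ ?V]) (auto simp: compose_def PiE_iff)
    qed
    show "compose ?V f ` digraph_embeddings H H \<subseteq> ?fibre"
    proof (rule image_subsetI, rule CollectI, rule conjI)
      fix h assume h: "h \<in> digraph_embeddings H H"
      note surj = embeddings_self_surj[OF H.finite_verts R_V h]
      have hV: "h x \<in> ?V" if "x \<in> ?V" for x using surj(1) that by blast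
      show emb: "compose ?V f h \<in> digraph_embeddings H T"
      proof (rule embeddingsI)
        show "compose ?V f h \<in> ?V \<rightarrow>\<^sub>E verts T"
          using hV f(1) by (auto simp: compose_def)
        show "inj_on (compose ?V f h) ?V"
          using comp_inj_on[OF embeddingsD(2)[OF h], of f] f(2) surj(1)
          by (simp add: compose_def inj_on_restrict_eq comp_def)
        show "(compose ?V f h x, compose ?V f h y) \<in> arcs_ends T" if "(x, y) \<in> ?R" for x y
          using that R_V f(3) embeddingsD(3)[OF h that] by (auto simp: compose_def)
      qed
      have "compose ?V f h ` ?V = f ` h ` ?V"
        by (simp add: image_image compose_def)
      moreover have "map_prod (compose ?V f h) (compose ?V f h) ` ?R
          = map_prod f f ` map_prod h h ` ?R"
        unfolding image_image using R_V by (intro image_cong) (auto simp: compose_def)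
      ultimately show "image_digraph H T (compose ?V f h) = image_digraph H T f"
        using image_digraph_eq_iff[OF emb assms(2)] surj by simp
    qed
    show "compose ?V ?k ` ?fibre \<subseteq> digraph_embeddings H H"
    proof (rule image_subsetI)
      fix g assume g: "g \<in> ?fibre"
      have gf: "f (?k (g x)) = g x" "?k (g x) \<in> ?V" if "x \<in> ?V" for x
        using fk[of "g x"] fibre(1)[OF g] that by blast+
      show "compose ?V ?k g \<in> digraph_embeddings H H"
      proof (rule embeddingsI)
        show "compose ?V ?k g \<in> ?V \<rightarrow>\<^sub>E ?V"
          using gf(2) by (simp add: compose_def)
        have "inj_on g ?V" using g embeddingsD(2) by blast
        then show "inj_on (compose ?V ?k g) ?V"
          using gf(1) unfolding inj_on_def compose_def by (metis restrict_apply')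
        show "(compose ?V ?k g x, compose ?V ?k g y) \<in> ?R" if "(x, y) \<in> ?R" for x y
        proof -
          have "map_prod g g (x, y) \<in> map_prod f f ` ?R"
            using fibre(2)[OF g] that by blast
          then obtain x' y' where "(x', y') \<in> ?R" "g x = f x'" "g y = f y'" by auto
          then show ?thesis using kf[of x'] kf[of y'] R_V that by (auto simp: compose_def)
        qed
      qed
    qed
  qed
  then show ?thesis by (simp add: bij_betw_same_card)
qed

text \<open>Double counting: the embeddings are grouped by their image, and all fibres have the same
  size.\<close>

lemma card_copies_times_automorphisms:
  assumes "digraph H" "digraph T"
  shows "card (copies H T) * card (digraph_embeddings H H) = card (digraph_embeddings H T)"
proof -
  interpret H: digraph H by fact
  interpret T: digraph T by fact
  let ?fibre = "\<lambda>S. {f \<in> digraph_embeddings H T. image_digraph H T f = S}"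
  have fin: "finite (digraph_embeddings H T)" by (simp add: finite_embeddings)
  have "card (?fibre S) = card (digraph_embeddings H H)" if S: "S \<in> copies H T" for S
  proof -
    obtain f where "f \<in> digraph_embeddings H T" "image_digraph H T f = S"
      using copies_eq_image_digraph[OF assms S] .
    then show ?thesis using card_image_digraph_fibre[OF assms(1), of f T] by simp
  qed
  moreover have "(\<Sum>S\<in>copies H T. \<Sum>f\<in>?fibre S. 1) = (\<Sum>f\<in>digraph_embeddings H T. 1 :: nat)"
    using fin T.finite_copies image_digraph_in_copies[OF assms] by (intro sum.group) auto
  ultimately show ?thesis by simp
qed

section \<open>Degrees in the underlying graph and the final comparison of counts\<close>

lemma degree_mk_symmetric:
  assumes "wf_digraph H" "finite (verts H)" "v \<in> verts H"
  shows "card ((arcs_ends H \<union> (arcs_ends H)\<inverse>) `` {v}) \<le> max_degree (with_proj (mk_symmetric H))"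
proof -
  have "out_arcs (with_proj (mk_symmetric H)) v = Pair v ` ((arcs_ends H \<union> (arcs_ends H)\<inverse>) `` {v})"
    by (auto simp: out_arcs_def mk_symmetric_def arcs_ends_conv image_iff)
  then have "card ((arcs_ends H \<union> (arcs_ends H)\<inverse>) `` {v}) = out_degree (with_proj (mk_symmetric H)) v"
    by (simp add: out_degree_def card_image inj_on_def)
  also have "\<dots> \<le> max_degree (with_proj (mk_symmetric H))"
    unfolding max_degree_def using assms(2,3) by (intro Max_ge) (auto simp: mk_symmetric_def)
  finally show ?thesis .
qed

theorem theorem23:
  fixes T :: "('a,'b) pre_digraph" and H :: "('c,'d) pre_digraph"
  assumes "tournament T"
    and "digraph H"
    and "max_degree (with_proj (mk_symmetric H)) \<le> 2"
  shows "card (copies H T) = card (copies H (complement T))"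
proof -
  interpret T: tournament T by fact
  interpret T': tournament "complement T" by (rule T.tournament_complement)
  interpret H: digraph H by fact
  let ?V = "verts H" and ?R = "arcs_ends H"
  interpret A: finite_tournament_relation "verts T" "arcs_ends T"
  proof
    show "finite (verts T)" by simp
    show "u \<rightarrow>\<^bsub>T\<^esub> v \<longleftrightarrow> (v, u) \<notin> arcs_ends T" if "u \<in> verts T" "v \<in> verts T" "u \<noteq> v" for u v
      using T.exactly_one_arc[OF that] .
  qed
  have R_V: "?R \<subseteq> ?V \<times> ?V" by (rule H.arcs_ends_subset)
  have "card (digraph_embeddings H T) = card (embeddings ?V (?R\<inverse>) (verts T) (arcs_ends T))"
  proof (cases "asym ?R")
    case True
    show ?thesis
    proof (rule A.card_embeddings_converse[OF H.finite_verts R_V True])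
      show "card ((?R \<union> ?R\<inverse>) `` {v}) \<le> 2" if "v \<in> ?V" for v
        using degree_mk_symmetric[OF H.wf_digraph H.finite_verts that] assms(3) by simp
    qed
  next
    case False
    \<comment> \<open>A failure of asymmetry yields opposite arcs, since \<open>H\<close> has no
      loops. The converse contains them too, so both counts vanish.\<close>
    then obtain u v where uv: "(u, v) \<in> ?R" "(v, u) \<in> ?R" by (auto simp: asym_iff)
    then have "u \<in> ?V" "v \<in> ?V" "u \<noteq> v" using R_V H.adj_not_same by auto
    then show ?thesis
      using A.embeddings_antiparallel uv by (metis converse_iff)
  qed
  also have "\<dots> = card (digraph_embeddings H (complement T))"
    by (simp only: embeddings_converse[symmetric] arcs_ends_complement)
      (simp add: complement_def)
  finally have "card (copies H T) * card (digraph_embeddings H H)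
      = card (copies H (complement T)) * card (digraph_embeddings H H)"
    by (simp only: card_copies_times_automorphisms[OF assms(2) T.digraph_axioms]
      card_copies_times_automorphisms[OF assms(2) T'.digraph_axioms])
  \<comment> \<open>The identity shows that the number of automorphisms is positive, so it can be
    cancelled.\<close>
  moreover have "restrict id ?V \<in> digraph_embeddings H H"
    using R_V by (auto simp: embeddings_def inj_on_def)
  then have "card (digraph_embeddings H H) > 0"
    by (auto simp: card_gt_0_iff finite_embeddings)
  ultimately show ?thesis by simp
qed

end
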